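(* Let $d,k$ be positive integers. There are only finitely many isomorphism classes of loopless matroids $M$ of rank $d$ whose independence complex $\mathcal{I}(M)$ satisfies $h_d(\mathcal{I}(M))=k$.
   Context: For a matroid $M$ on ground set $E$, the independence complex $\mathcal{I}(M)$ is the simplicial complex on $E$ whose faces are the independent sets of $M$; if $M$ has rank $d$ it has dimension $d-1$. A loop is an element $x$ with $r(\{x\})=0$; $M$ is loopless if it has none. For a $(d-1)$-dimensional simplicial complex $\Delta$ with $f_{i}$ faces of dimension $i$ (so $f_{-1}=1$), the $h$-vector $(h_0,\dots,h_d)$ is defined by $\sum_{i=0}^d h_i t^i=\sum_{i=0}^d f_{i-1}t^i(1-t)^{d-i}$. *)

theory Defs
  imports Main "HOL-Computational_Algebra.Polynomial"
begin

record 'a set_system =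
  ground :: "'a set"
  indep :: "'a set set"

locale matroid =
  fixes M :: "'a set_system"
  assumes finite_ground: "finite (ground M)"
    and indep_subset_ground: "\<And>I. I \<in> indep M \<Longrightarrow> I \<subseteq> ground M"
    and indep_empty: "{} \<in> indep M"
    and indep_subset: "\<And>I J. I \<in> indep M \<Longrightarrow> J \<subseteq> I \<Longrightarrow> J \<in> indep M"
    and indep_augment: "\<And>I J. I \<in> indep M \<Longrightarrow> J \<in> indep M \<Longrightarrow> card I < card J \<Longrightarrow>
      \<exists>x \<in> J - I. insert x I \<in> indep M"

definition rank_of :: "'a set_system \<Rightarrow> 'a set \<Rightarrow> nat" where
  "rank_of M X = Max (card ` {I \<in> indep M. I \<subseteq> X})"

definition matroid_rank :: "'a set_system \<Rightarrow> nat" where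
  "matroid_rank M = rank_of M (ground M)"

definition is_loop :: "'a set_system \<Rightarrow> 'a \<Rightarrow> bool" where
  "is_loop M x \<longleftrightarrow> x \<in> ground M \<and> rank_of M {x} = 0"

definition loopless :: "'a set_system \<Rightarrow> bool" where
  "loopless M \<longleftrightarrow> (\<nexists>x. is_loop M x)"

definition matroid_iso :: "'a set_system \<Rightarrow> 'b set_system \<Rightarrow> bool" where
  "matroid_iso M N \<longleftrightarrow> (\<exists>f. bij_betw f (ground M) (ground N) \<and>
     (\<forall>X \<subseteq> ground M. X \<in> indep M \<longleftrightarrow> f ` X \<in> indep N))"

definition matroid_iso_rel :: "('a set_system \<times> 'a set_system) set" where
  "matroid_iso_rel = {(M, N). matroid M \<and> matroid N \<and> matroid_iso M N}"

text \<open>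
  A finite simplicial complex is represented by its set of faces, the empty face included. The
  empty face has dimension \<open>-1\<close>, so dimensions are integers.
\<close>

definition face_dim :: "'a set \<Rightarrow> int" where
  "face_dim F = int (card F) - 1"

definition complex_dim :: "'a set set \<Rightarrow> int" where
  "complex_dim \<Delta> = Max (face_dim ` \<Delta>)"

definition f_num :: "'a set set \<Rightarrow> int \<Rightarrow> nat" where
  "f_num \<Delta> i = card {F \<in> \<Delta>. face_dim F = i}"

text \<open>
  With \<open>d = dim \<Delta> + 1\<close>, this is the polynomial \<open>\<Sum>i=0..d. f\<^bsub>i-1\<^esub> t\<^sup>i (1 - t)\<^bsup>d-i\<^esup>\<close>.
\<close>

definition h_poly :: "'a set set \<Rightarrow> int poly" where
  "h_poly \<Delta> = (let d = nat (complex_dim \<Delta> + 1) in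
     \<Sum>i=0..d. monom (int (f_num \<Delta> (int i - 1))) i * [:1, -1:] ^ (d - i))"

definition h_num :: "'a set set \<Rightarrow> nat \<Rightarrow> int" where
  "h_num \<Delta> i = coeff (h_poly \<Delta>) i"

definition independence_complex :: "'a set_system \<Rightarrow> 'a set set" where
  "independence_complex M = indep M"

lemma matroid_iso_refl: "matroid_iso M M"
  unfolding matroid_iso_def by (rule exI[of _ id]) auto

lemma matroid_iso_sym:
  assumes "matroid_iso M N"
  shows "matroid_iso N M"
proof -
  obtain f where f: "bij_betw f (ground M) (ground N)"
    and I: "\<And>X. X \<subseteq> ground M \<Longrightarrow> X \<in> indep M \<longleftrightarrow> f ` X \<in> indep N"
    using assms unfolding matroid_iso_def by blast
  let ?g = "inv_into (ground M) f"
  have "Y \<in> indep N \<longleftrightarrow> ?g ` Y \<in> indep M" if "Y \<subseteq> ground N" for Y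
  proof -
    have "f ` ?g ` Y = Y"
      using that f by (metis bij_betw_imp_surj_on image_inv_into_cancel)
    moreover have "?g ` Y \<subseteq> ground M"
      using that f by (metis bij_betw_def bij_betw_inv_into image_mono)
    ultimately show ?thesis using I by metis
  qed
  then show ?thesis
    unfolding matroid_iso_def using bij_betw_inv_into[OF f] by blast
qed

lemma matroid_iso_trans:
  assumes "matroid_iso M N" "matroid_iso N K"
  shows "matroid_iso M K"
proof -
  obtain f where f: "bij_betw f (ground M) (ground N)"
    and I: "\<And>X. X \<subseteq> ground M \<Longrightarrow> X \<in> indep M \<longleftrightarrow> f ` X \<in> indep N"
    using assms(1) unfolding matroid_iso_def by blast
  obtain g where g: "bij_betw g (ground N) (ground K)"
    and J: "\<And>X. X \<subseteq> ground N \<Longrightarrow> X \<in> indep N \<longleftrightarrow> g ` X \<in> indep K"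
    using assms(2) unfolding matroid_iso_def by blast
  have "X \<in> indep M \<longleftrightarrow> (g \<circ> f) ` X \<in> indep K" if "X \<subseteq> ground M" for X
  proof -
    have "f ` X \<subseteq> ground N"
      using that f by (metis bij_betw_def image_mono)
    then show ?thesis using I[OF that] J by (simp add: image_comp)
  qed
  then show ?thesis
    unfolding matroid_iso_def using bij_betw_trans[OF f g] by blast
qed

lemma equiv_matroid_iso_rel: "equiv {M. matroid M} matroid_iso_rel"
  unfolding matroid_iso_rel_def
  by (auto intro!: equivI refl_onI symI transI
      intro: matroid_iso_refl matroid_iso_sym matroid_iso_trans)

lemma (in matroid) complex_dim_independence_complex:
  "complex_dim (independence_complex M) = int (matroid_rank M) - 1"
proof -
  have fin: "finite (indep M)"
    using finite_ground indep_subset_ground by (meson Pow_iff finite_Pow_iff finite_subset subsetI)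
  have eq: "{I \<in> indep M. I \<subseteq> ground M} = indep M"
    using indep_subset_ground by blast
  have "mono (\<lambda>n::nat. int n - 1)" by (simp add: mono_def)
  then have "int (Max (card ` indep M)) - 1 = Max ((\<lambda>n. int n - 1) ` card ` indep M)"
    using fin indep_empty by (subst mono_Max_commute) auto
  then show ?thesis
    by (simp add: complex_dim_def independence_complex_def matroid_rank_def rank_of_def eq
        image_image face_dim_def)
qed

end

theory Submission
  imports Defs
begin

text \<open>
  Up to sign, \<open>h\<^sub>d\<close> is the reduced Euler characteristic of the independence complex. It vanishes if
  there is a coloop and otherwise satisfies \<open>h(M) = h(M \ e) + h(M / e)\<close> for every non-loop \<open>e\<close>.
  Contraction creates no coloops, so by induction \<open>h \<ge> 1\<close> for coloop-free matroids. Splitting off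
  the elements parallel to \<open>e\<close> one at a time, each contributing \<open>h(M / e) \<ge> 1\<close>, shows that
  at most \<open>k\<close> elements are parallel to \<open>e\<close>; the remaining non-loops are non-loops of
  \<open>M / e\<close>, which has rank \<open>d - 1\<close> and \<open>h(M / e) \<le> k\<close>. Hence a loopless \<open>M\<close> has at most
  \<open>d (k + 1)\<close> elements.
\<close>

section \<open>Minors, coloops and the signed Euler characteristic\<close>

definition deletion :: "'a set_system \<Rightarrow> 'a \<Rightarrow> 'a set_system" where
  "deletion M e = \<lparr>ground = ground M - {e}, indep = {I \<in> indep M. e \<notin> I}\<rparr>"

text \<open>Only meaningful for a non-loop \<open>e\<close>: otherwise there are no independent sets left.\<close>

definition contraction :: "'a set_system \<Rightarrow> 'a \<Rightarrow> 'a set_system" where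
  "contraction M e = \<lparr>ground = ground M - {e}, indep = {I. e \<notin> I \<and> insert e I \<in> indep M}\<rparr>"

text \<open>Equivalent in a matroid to lying in every basis. In this form the negation directly
  supplies an independent set that \<open>e\<close> cannot join.\<close>

definition is_coloop :: "'a set_system \<Rightarrow> 'a \<Rightarrow> bool" where
  "is_coloop M e \<longleftrightarrow> e \<in> ground M \<and> (\<forall>I \<in> indep M. insert e I \<in> indep M)"

text \<open>The reduced Euler characteristic up to the sign that makes it equal to h_d. The exponent
  adds the cardinality instead of subtracting it: same parity, no truncated subtraction.\<close>

definition signed_euler_char :: "'a set_system \<Rightarrow> int" where
  "signed_euler_char M = (\<Sum>I\<in>indep M. (-1) ^ (matroid_rank M + card I))"

lemma deletion_sel [simp]:
  "ground (deletion M e) = ground M - {e}" "indep (deletion M e) = {I \<in> indep M. e \<notin> I}"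
  by (simp_all add: deletion_def)

lemma contraction_sel [simp]:
  "ground (contraction M e) = ground M - {e}"
  "indep (contraction M e) = {I. e \<notin> I \<and> insert e I \<in> indep M}"
  by (simp_all add: contraction_def)

lemma coeff_one_minus_X_power: "coeff ([:1, -1 :: int:] ^ n) n = (-1) ^ n"
proof -
  have "coeff ([:1, -1 :: int:] ^ n) n = lead_coeff ([:1, -1 :: int:] ^ n)"
    by (simp add: degree_power_eq)
  also have "\<dots> = (-1) ^ n"
    by (subst lead_coeff_power) simp
  finally show ?thesis .
qed

section \<open>Rank and extension to bases\<close>

context matroid
begin

lemma finite_indep: "finite (indep M)"
  by (rule finite_subset[of _ "Pow (ground M)"]) (auto simp: finite_ground dest: indep_subset_ground)

lemma finite_member: "I \<in> indep M \<Longrightarrow> finite I"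
  using indep_subset_ground finite_ground finite_subset by blast

lemma matroid_rank_eq_Max: "matroid_rank M = Max (card ` indep M)"
proof -
  have "{I \<in> indep M. I \<subseteq> ground M} = indep M"
    using indep_subset_ground by blast
  then show ?thesis
    by (simp add: matroid_rank_def rank_of_def)
qed

lemma card_le_rank: "I \<in> indep M \<Longrightarrow> card I \<le> matroid_rank M"
  by (simp add: matroid_rank_eq_Max finite_indep)

lemma obtain_basis:
  obtains B where "B \<in> indep M" "card B = matroid_rank M"
proof -
  have "Max (card ` indep M) \<in> card ` indep M"
    using finite_indep indep_empty by (intro Max_in) auto
  then show ?thesis
    using that by (metis (no_types, lifting) imageE matroid_rank_eq_Max)
qed

lemma matroid_rank_eqI:
  assumes "B \<in> indep M" "card B = r" "\<And>I. I \<in> indep M \<Longrightarrow> card I \<le> r"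
  shows "matroid_rank M = r"
  using assms by (metis card_le_rank le_antisym obtain_basis)

text \<open>Repeated augmentation of \<open>I\<close> from \<open>J\<close>. The bound
  \<open>K \<subseteq> I \<union> J\<close> controls which elements enter, as the exchange arguments
  below require.\<close>

lemma extend_indep:
  assumes "J \<in> indep M" "I \<in> indep M" "card I \<le> card J"
  shows "\<exists>K \<in> indep M. I \<subseteq> K \<and> K \<subseteq> I \<union> J \<and> card K = card J"
  using assms(2,3)
proof (induction "card J - card I" arbitrary: I)
  case 0
  then show ?case by auto
next
  case (Suc n)
  then obtain x where x: "x \<in> J - I" "insert x I \<in> indep M"
    using indep_augment[of I J] assms(1) by (metis zero_less_Suc zero_less_diff)
  have "card (insert x I) = Suc (card I)"
    using x Suc.prems finite_member by auto
  then have "\<exists>K \<in> indep M. insert x I \<subseteq> K \<and> K \<subseteq> insert x I \<union> J \<and> card K = card J"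
    using Suc x by (intro Suc.hyps(1)) auto
  then show ?case
    using x by blast
qed

section \<open>Minors are matroids, and their ranks\<close>

lemma matroid_deletion: "matroid (deletion M e)"
proof unfold_locales
  fix I J
  assume "I \<in> indep (deletion M e)" "J \<in> indep (deletion M e)" "card I < card J"
  then show "\<exists>x\<in>J - I. insert x I \<in> indep (deletion M e)"
    using indep_augment[of I J] by auto
qed (use finite_ground indep_subset_ground indep_empty indep_subset in auto)

lemma matroid_contraction:
  assumes "{e} \<in> indep M"
  shows "matroid (contraction M e)"
proof unfold_locales
  fix I J
  assume I: "I \<in> indep (contraction M e)" and J: "J \<in> indep (contraction M e)" and "card I < card J"
  then have "finite I" "finite J"
    using finite_member by (metis (no_types, lifting) contraction_sel(2) finite_insert mem_Collect_eq)+
  then have "card (insert e I) < card (insert e J)"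
    using I J \<open>card I < card J\<close> by simp
  then obtain x where "x \<in> insert e J - insert e I" "insert x (insert e I) \<in> indep M"
    using indep_augment[of "insert e I" "insert e J"] I J by auto
  then show "\<exists>x\<in>J - I. insert x I \<in> indep (contraction M e)"
    using I by (auto simp: insert_commute)
next
  fix I J
  assume "I \<in> indep (contraction M e)" "J \<subseteq> I"
  then show "J \<in> indep (contraction M e)"
    using indep_subset[of "insert e I" "insert e J"] by auto
qed (use assms finite_ground indep_subset_ground in auto)

text \<open>An independent set that \<open>e\<close> cannot join extends to a basis; this basis
  avoids \<open>e\<close> and so survives the deletion.\<close>

lemma rank_deletion:
  assumes "e \<in> ground M" "\<not> is_coloop M e"
  shows "matroid_rank (deletion M e) = matroid_rank M"
proof -
  interpret D: matroid "deletion M e" by (rule matroid_deletion)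
  obtain I where I: "I \<in> indep M" "insert e I \<notin> indep M"
    using assms by (auto simp: is_coloop_def)
  obtain B where B: "B \<in> indep M" "card B = matroid_rank M"
    by (rule obtain_basis)
  obtain K where K: "K \<in> indep M" "I \<subseteq> K" "card K = matroid_rank M"
    using extend_indep[of B I] B I card_le_rank by metis
  then have "e \<notin> K"
    using I indep_subset[of K "insert e I"] by auto
  then show ?thesis
    using K card_le_rank by (intro D.matroid_rank_eqI[of K]) auto
qed

lemma rank_contraction:
  assumes "{e} \<in> indep M"
  shows "matroid_rank M = Suc (matroid_rank (contraction M e))"
proof -
  interpret C: matroid "contraction M e" by (rule matroid_contraction[OF assms])
  obtain B where B: "B \<in> indep M" "card B = matroid_rank M"
    by (rule obtain_basis)
  obtain K where K: "K \<in> indep M" "{e} \<subseteq> K" "card K = matroid_rank M"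
    using extend_indep[of B "{e}"] B assms card_le_rank by metis
  have fin: "finite K" using K finite_member by blast
  have "matroid_rank (contraction M e) = matroid_rank M - 1"
  proof (rule C.matroid_rank_eqI)
    show "K - {e} \<in> indep (contraction M e)"
      using K by (auto simp: insert_absorb)
    show "card (K - {e}) = matroid_rank M - 1"
      using K fin by simp
    fix I assume I: "I \<in> indep (contraction M e)"
    then have "card (insert e I) = Suc (card I)"
      using C.finite_member by auto
    then show "card I \<le> matroid_rank M - 1"
      using card_le_rank[of "insert e I"] I by auto
  qed
  \<comment> \<open>Since \<open>{e}\<close> is independent the rank is at least 1, so the truncated
    subtraction is exact.\<close>
  then show ?thesis
    using card_le_rank[OF assms] by simp
qed

section \<open>Deletion-contraction recursion\<close>

lemma indep_containing_eq:
  "{I \<in> indep M. e \<in> I} = insert e ` indep (contraction M e)"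
proof
  show "{I \<in> indep M. e \<in> I} \<subseteq> insert e ` indep (contraction M e)"
  proof
    fix I assume "I \<in> {I \<in> indep M. e \<in> I}"
    then show "I \<in> insert e ` indep (contraction M e)"
      by (intro image_eqI[of _ _ "I - {e}"]) (auto simp: insert_absorb)
  qed
qed auto

text \<open>Inserting \<open>e\<close> maps the independent sets of the contraction onto those
  containing \<open>e\<close> and flips the sign. The offset \<open>r\<close> is kept free because
  the minors may differ from \<open>M\<close> in rank.\<close>

lemma sum_indep_split:
  fixes r :: nat
  shows "(\<Sum>I\<in>indep M. (-1) ^ (r + card I)) =
    (\<Sum>I\<in>indep (deletion M e). (-1) ^ (r + card I)) -
    (\<Sum>I\<in>indep (contraction M e). (-1) ^ (r + card I) :: int)"
proof -
  have "(\<Sum>I\<in>{I \<in> indep M. e \<in> I}. (-1) ^ (r + card I)) =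
      (\<Sum>I\<in>indep (contraction M e). (-1) ^ (r + card (insert e I)) :: int)"
    unfolding indep_containing_eq
    by (rule sum.reindex_cong[of "insert e"]) (auto simp: inj_on_def)
  also have "\<dots> = (\<Sum>I\<in>indep (contraction M e). - ((-1) ^ (r + card I)))"
  proof (rule sum.cong)
    fix I assume I: "I \<in> indep (contraction M e)"
    then have "finite I"
      using finite_member[of "insert e I"] by auto
    then show "(-1) ^ (r + card (insert e I)) = - ((-1) ^ (r + card I) :: int)"
      using I by simp
  qed simp
  finally have contr: "(\<Sum>I\<in>{I \<in> indep M. e \<in> I}. (-1) ^ (r + card I)) =
      - (\<Sum>I\<in>indep (contraction M e). (-1) ^ (r + card I) :: int)"
    by (simp add: sum_negf)
  have "(\<Sum>I\<in>indep M. (-1) ^ (r + card I)) =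
      (\<Sum>I\<in>{I \<in> indep M. e \<notin> I} \<union> {I \<in> indep M. e \<in> I}. (-1) ^ (r + card I) :: int)"
    by (rule sum.cong) auto
  also have "\<dots> = (\<Sum>I\<in>{I \<in> indep M. e \<notin> I}. (-1) ^ (r + card I)) +
      (\<Sum>I\<in>{I \<in> indep M. e \<in> I}. (-1) ^ (r + card I))"
    using finite_indep by (intro sum.union_disjoint) auto
  finally show ?thesis
    using contr by simp
qed

text \<open>The complex is a cone with apex \<open>e\<close>: deletion and contraction have the same
  independent sets, so the two sums cancel.\<close>

lemma signed_euler_char_coloop:
  assumes "is_coloop M e"
  shows "signed_euler_char M = 0"
proof -
  have "indep (contraction M e) = indep (deletion M e)"
    using assms indep_subset by (auto simp: is_coloop_def)
  then show ?thesis
    unfolding signed_euler_char_def by (subst sum_indep_split[of _ e]) simp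
qed

text \<open>The rank drops by one under contraction, which turns the minus of
  \<open>sum_indep_split\<close> into a plus; deletion keeps the rank.\<close>

lemma signed_euler_char_rec:
  assumes "{e} \<in> indep M" "\<not> is_coloop M e"
  shows "signed_euler_char M =
    signed_euler_char (deletion M e) + signed_euler_char (contraction M e)"
proof -
  have "e \<in> ground M" using assms indep_subset_ground by auto
  then show ?thesis
    unfolding signed_euler_char_def rank_deletion[OF \<open>e \<in> ground M\<close> assms(2)]
    by (subst sum_indep_split[of _ e]) (simp add: rank_contraction[OF assms(1)] sum_negf)
qed

text \<open>Some basis \<open>K\<close> avoids \<open>x\<close>, and exchanging \<open>e\<close>
  into it gives a basis \<open>L\<close> that contains \<open>e\<close> and still avoids
  \<open>x\<close>. A coloop \<open>x\<close> of the contraction could be added to \<open>L\<close>,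
  exceeding the rank.\<close>

lemma not_coloop_contraction:
  assumes "{e} \<in> indep M" "\<not> is_coloop M x"
  shows "\<not> is_coloop (contraction M e) x"
proof
  assume col: "is_coloop (contraction M e) x"
  then have x: "x \<in> ground M" "x \<noteq> e" by (auto simp: is_coloop_def)
  then obtain I where I: "I \<in> indep M" "insert x I \<notin> indep M"
    using assms by (auto simp: is_coloop_def)
  obtain B where B: "B \<in> indep M" "card B = matroid_rank M"
    by (rule obtain_basis)
  obtain K where K: "K \<in> indep M" "I \<subseteq> K" "card K = matroid_rank M"
    using extend_indep[of B I] B I card_le_rank by metis
  have xK: "x \<notin> K"
    using I K indep_subset[of K "insert x I"] by auto
  obtain L where L: "L \<in> indep M" "{e} \<subseteq> L" "L \<subseteq> {e} \<union> K" "card L = matroid_rank M"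
    using extend_indep[of K "{e}"] K assms card_le_rank by metis
  have "L - {e} \<in> indep (contraction M e)"
    using L by (auto simp: insert_absorb)
  then have "insert x (L - {e}) \<in> indep (contraction M e)"
    using col by (auto simp: is_coloop_def)
  moreover have "insert e (insert x (L - {e})) = insert x L"
    using L by auto
  ultimately have "insert x L \<in> indep M"
    by simp
  moreover have "x \<notin> L" using L xK x by auto
  ultimately have "Suc (matroid_rank M) \<le> matroid_rank M"
    using card_le_rank[of "insert x L"] L finite_member by auto
  then show False by simp
qed

section \<open>Contraction by parallel elements\<close>

lemma indep_insert_parallel:
  assumes "{q} \<in> indep M" "{e, q} \<notin> indep M" "e \<notin> I" "insert e I \<in> indep M"
  shows "q \<notin> I \<and> insert q I \<in> indep M"
proof -
  have q: "q \<notin> I"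
    using assms indep_subset[of "insert e I" "{e, q}"] by auto
  have fin: "finite I" using finite_member[OF assms(4)] by simp
  have "card {q} \<le> card (insert e I)" using fin assms by simp
  then obtain K where K: "K \<in> indep M" "{q} \<subseteq> K" "K \<subseteq> {q} \<union> insert e I"
      "card K = card (insert e I)"
    using extend_indep[OF assms(4,1)] by metis
  \<comment> \<open>\<open>K\<close> contains \<open>q\<close> and hence not \<open>e\<close>, so by
    its size it can only be \<open>insert q I\<close>.\<close>
  have "e \<notin> K" using K assms indep_subset[of K "{e, q}"] by auto
  then have "K \<subseteq> insert q I" using K by auto
  moreover have "card K = card (insert q I)" using K q fin assms by simp
  ultimately have "K = insert q I" using fin by (simp add: card_subset_eq)
  then show ?thesis using K q by simp
qed

text \<open>Exchanging \<open>e\<close> and \<open>q\<close> in both directions identifies the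
  independent sets of the two contractions. Their ground sets still differ, so the ranks are
  compared separately.\<close>

lemma signed_euler_char_contraction_parallel:
  assumes "{e} \<in> indep M" "{q} \<in> indep M" "{e, q} \<notin> indep M"
  shows "signed_euler_char (contraction M q) = signed_euler_char (contraction M e)"
proof -
  have "indep (contraction M q) = indep (contraction M e)"
  proof (intro set_eqI)
    fix I
    have "{q, e} \<notin> indep M" using assms(3) by (simp add: insert_commute)
    then show "I \<in> indep (contraction M q) \<longleftrightarrow> I \<in> indep (contraction M e)"
      using indep_insert_parallel[OF assms(2,3), of I] indep_insert_parallel[OF assms(1), of q I]
      by auto
  qed
  moreover have "matroid_rank (contraction M q) = matroid_rank (contraction M e)"
    using rank_contraction assms by (metis nat.inject)
  ultimately show ?thesis by (simp add: signed_euler_char_def)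
qed

section \<open>The top entry of the h-vector\<close>

lemma coeff_h_poly_rank:
  "h_num (independence_complex M) (matroid_rank M) = signed_euler_char M"
proof -
  let ?d = "matroid_rank M"
  have f: "f_num (indep M) (int i - 1) = card {I \<in> indep M. card I = i}" for i
    by (simp add: f_num_def face_dim_def)
  \<comment> \<open>In degree d, the product t^i (1 - t)^(d-i) contributes the leading coefficient
    of its second factor.\<close>
  have "h_num (independence_complex M) ?d =
      (\<Sum>i=0..?d. int (card {I \<in> indep M. card I = i}) * (-1) ^ (?d - i))"
    unfolding h_num_def h_poly_def complex_dim_independence_complex Let_def
    by (auto simp: coeff_sum coeff_monom_mult independence_complex_def f coeff_one_minus_X_power
        intro!: sum.cong)
  also have "\<dots> = (\<Sum>i=0..?d. \<Sum>I\<in>{I \<in> indep M. card I = i}. (-1) ^ (?d + card I))"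
  proof (rule sum.cong)
    fix i assume "i \<in> {0..?d}"
    \<comment> \<open>As \<open>i \<le> ?d\<close>, the exponents differ by exactly
      \<open>2 * i\<close>.\<close>
    then have "(-1 :: int) ^ (?d - i) = (-1) ^ (?d + i)"
      by (simp add: uminus_power_if)
    then show "int (card {I \<in> indep M. card I = i}) * (-1) ^ (?d - i) =
        (\<Sum>I\<in>{I \<in> indep M. card I = i}. (-1) ^ (?d + card I))"
      by simp
  qed simp
  also have "\<dots> = signed_euler_char M"
    unfolding signed_euler_char_def
    using finite_indep card_le_rank by (intro sum.group) auto
  finally show ?thesis .
qed

end

section \<open>Positivity and the bound on non-loops\<close>

lemma signed_euler_char_pos:
  assumes "matroid M" "\<And>x. \<not> is_coloop M x"
  shows "signed_euler_char M \<ge> 1"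
  using assms
proof (induction "card (ground M)" arbitrary: M rule: less_induct)
  case less
  interpret matroid M by fact
  show ?case
  proof (cases "\<exists>e. {e} \<in> indep M")
    case True
    then obtain e where e: "{e} \<in> indep M" by blast
    then have eg: "e \<in> ground M" using indep_subset_ground by auto
    interpret D: matroid "deletion M e" by (rule matroid_deletion)
    interpret C: matroid "contraction M e" by (rule matroid_contraction[OF e])
    have card: "card (ground M - {e}) < card (ground M)"
      using eg finite_ground by (rule card_Diff1_less[rotated])
    \<comment> \<open>Unlike contraction, deletion can create coloops. Its value is then 0, and the
      contraction alone supplies the required 1.\<close>
    have "signed_euler_char (deletion M e) \<ge> 0"
    proof (cases "\<exists>x. is_coloop (deletion M e) x")
      case True
      then show ?thesis using D.signed_euler_char_coloop by auto
    next
      case False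
      then show ?thesis
        using less.hyps[of "deletion M e"] card D.matroid_axioms by force
    qed
    moreover have "signed_euler_char (contraction M e) \<ge> 1"
      using less.hyps[of "contraction M e"] card C.matroid_axioms
        not_coloop_contraction[OF e] less.prems(2) by simp
    ultimately show ?thesis
      using signed_euler_char_rec[OF e] less.prems(2) by simp
  next
    case False
    \<comment> \<open>Only loops remain: the rank is 0 and the empty face contributes 1.\<close>
    then have "I = {}" if "I \<in> indep M" for I
      using that indep_subset[of I] by (metis empty_subsetI insert_subset ex_in_conv)
    then have I: "indep M = {{}}" using indep_empty by auto
    then show ?thesis
      by (simp add: signed_euler_char_def matroid_rank_eq_Max)
  qed
qed

lemma signed_euler_char_nonneg:
  assumes "matroid M"
  shows "signed_euler_char M \<ge> 0"
proof (cases "\<exists>x. is_coloop M x")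
  case True
  then show ?thesis
    using matroid.signed_euler_char_coloop[OF assms] by auto
next
  case False
  then show ?thesis
    using signed_euler_char_pos[OF assms] by force
qed

text \<open>Each deletion of some \<open>q\<close> in \<open>Q\<close> lowers the value by that of
  \<open>contraction M q\<close>, which equals that of \<open>contraction M e\<close>. Positivity of
  the latter is the invariant, since absence of coloops in \<open>M\<close> can be lost under
  deletion.\<close>

lemma card_parallel_le_signed_euler_char:
  assumes "finite Q" "matroid M" "{e} \<in> indep M" "e \<notin> Q"
    and "\<And>q. q \<in> Q \<Longrightarrow> {q} \<in> indep M \<and> {e, q} \<notin> indep M"
    and "signed_euler_char (contraction M e) \<ge> 1"
  shows "signed_euler_char M \<ge> int (card Q)"
  using assms
proof (induction Q arbitrary: M rule: finite_induct)
  case empty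
  then show ?case using signed_euler_char_nonneg by simp
next
  case (insert q Q)
  interpret matroid M by fact
  interpret D: matroid "deletion M q" by (rule matroid_deletion)
  have q: "{q} \<in> indep M" "{e, q} \<notin> indep M" "q \<noteq> e" using insert.prems by auto
  \<comment> \<open>\<open>{e}\<close> is an independent set that \<open>q\<close> cannot
    join.\<close>
  have ncol: "\<not> is_coloop M q"
    using q insert.prems(2) unfolding is_coloop_def by (metis insert_commute)
  have eD: "{e} \<in> indep (deletion M q)" using insert.prems q by auto
  \<comment> \<open>\<open>q\<close> is a loop after contracting \<open>e\<close>, so deleting it
    first leaves the independent sets of that contraction unchanged.\<close>
  have q_loop: "q \<notin> I" if "insert e I \<in> indep M" for I
    using q indep_subset[OF that, of "{e, q}"] by auto
  have "indep (contraction (deletion M q) e) = indep (contraction M e)"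
    using q_loop q(3) by auto
  moreover have "matroid_rank (contraction (deletion M q) e) = matroid_rank (contraction M e)"
    using rank_contraction[OF insert.prems(2)] D.rank_contraction[OF eD]
      rank_deletion[OF _ ncol] q(1) indep_subset_ground[OF q(1)] by simp
  ultimately have "signed_euler_char (contraction (deletion M q) e) =
      signed_euler_char (contraction M e)"
    by (simp add: signed_euler_char_def)
  then have "signed_euler_char (deletion M q) \<ge> int (card Q)"
    using insert.prems insert.hyps eD D.matroid_axioms by (intro insert.IH) auto
  moreover have "signed_euler_char (contraction M q) \<ge> 1"
    using signed_euler_char_contraction_parallel[OF insert.prems(2) q(1,2)] insert.prems by simp
  ultimately show ?case
    using signed_euler_char_rec[OF q(1) ncol] insert.hyps by simp
qed

text \<open>Induction on the rank. Non-loops are counted, not all elements, because contracting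
  \<open>e\<close> turns its parallel elements into loops.\<close>

lemma card_nonloops_le:
  assumes "matroid M" "\<And>x. \<not> is_coloop M x" "signed_euler_char M \<le> int k"
  shows "card {x. {x} \<in> indep M} \<le> matroid_rank M * (k + 1)"
  using assms
proof (induction "matroid_rank M" arbitrary: M)
  case 0
  interpret matroid M by fact
  have "{x. {x} \<in> indep M} = {}"
    using card_le_rank 0 by fastforce
  then show ?case by (metis card.empty zero_le)
next
  case (Suc d)
  interpret matroid M by fact
  have nl: "{x. {x} \<in> indep N} \<subseteq> ground N" if "matroid N" for N :: "'a set_system"
    using matroid.indep_subset_ground[OF that] by blast
  show ?case
  proof (cases "\<exists>e. {e} \<in> indep M")
    case False
    then have "{x. {x} \<in> indep M} = {}" by blast
    then show ?thesis by (metis card.empty zero_le)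
  next
    case True
    then obtain e where e: "{e} \<in> indep M" by blast
    interpret C: matroid "contraction M e" by (rule matroid_contraction[OF e])
    define Q where "Q = {q. {q} \<in> indep M \<and> {e, q} \<notin> indep M}"
    have finQ: "finite Q"
      using nl[OF matroid_axioms] finite_ground by (auto simp: Q_def intro: finite_subset)
    have pos: "signed_euler_char (contraction M e) \<ge> 1"
      using signed_euler_char_pos[OF C.matroid_axioms] not_coloop_contraction[OF e] Suc.prems(2)
      by blast
    have "int (card Q) \<le> signed_euler_char M"
      using finQ pos e matroid_axioms
      by (intro card_parallel_le_signed_euler_char[of Q M e]) (auto simp: Q_def)
    then have cQ: "card Q \<le> k" using Suc.prems(3) by simp
    \<comment> \<open>The deletion's share is nonnegative, so the bound passes to the
      contraction.\<close>
    have "signed_euler_char (contraction M e) \<le> int k"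
      using signed_euler_char_rec[OF e Suc.prems(2)] signed_euler_char_nonneg[OF matroid_deletion[of e]]
        Suc.prems(3) by simp
    moreover have rk: "matroid_rank (contraction M e) = d"
      using rank_contraction[OF e] Suc.hyps(2) by simp
    ultimately have IH: "card {x. {x} \<in> indep (contraction M e)} \<le> d * (k + 1)"
      using Suc.hyps(1)[of "contraction M e"] C.matroid_axioms not_coloop_contraction[OF e]
        Suc.prems(2) by simp
    have finC: "finite {x. {x} \<in> indep (contraction M e)}"
      using nl[OF C.matroid_axioms] C.finite_ground by (rule finite_subset)
    \<comment> \<open>A non-loop other than \<open>e\<close> is either parallel to \<open>e\<close>
      or remains a non-loop in the contraction.\<close>
    have "{x. {x} \<in> indep M} \<subseteq> insert e Q \<union> {x. {x} \<in> indep (contraction M e)}"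
      by (auto simp: Q_def)
    then have "card {x. {x} \<in> indep M} \<le> card (insert e Q \<union> {x. {x} \<in> indep (contraction M e)})"
      using finQ finC by (intro card_mono) auto
    also have "\<dots> \<le> card (insert e Q) + card {x. {x} \<in> indep (contraction M e)}"
      by (rule card_Un_le)
    \<comment> \<open>The first \<open>k + 1\<close> counts \<open>e\<close> and its at most
      \<open>k\<close> parallel elements.\<close>
    also have "\<dots> \<le> (k + 1) + d * (k + 1)"
      using IH cQ card_insert_le_m1[of "k + 1" Q e] by simp
    finally show ?thesis using Suc.hyps(2)[symmetric] by simp
  qed
qed

section \<open>From bounded ground sets to finitely many classes\<close>

lemma (in matroid) loopless_imp_singleton_indep:
  assumes "loopless M" "x \<in> ground M"
  shows "{x} \<in> indep M"
proof (rule ccontr)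
  assume "{x} \<notin> indep M"
  then have "{I \<in> indep M. I \<subseteq> {x}} = {{}}"
    using indep_empty by (auto simp: subset_singleton_iff)
  then have "is_loop M x"
    using assms by (simp add: is_loop_def rank_of_def)
  then show False using assms by (auto simp: loopless_def)
qed

lemma (in matroid) iso_to_initial_segment:
  assumes "card (ground M) \<le> n"
  shows "\<exists>N :: nat set_system. ground N \<subseteq> {..<n} \<and> indep N \<subseteq> Pow {..<n} \<and> matroid_iso M N"
proof -
  obtain f where f: "bij_betw f (ground M) {0..<card (ground M)}"
    using ex_bij_betw_finite_nat[OF finite_ground] by blast
  define N where "N = \<lparr>ground = f ` ground M, indep = (`) f ` indep M\<rparr>"
  have inj: "inj_on f (ground M)" using f by (rule bij_betw_imp_inj_on)
  have img: "f ` ground M \<subseteq> {..<n}" using f assms by (auto simp: bij_betw_def)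
  have "f ` X \<in> (`) f ` indep M \<longleftrightarrow> X \<in> indep M" if "X \<subseteq> ground M" for X
    using that inj indep_subset_ground by (auto simp: inj_on_image_eq_iff)
  then have "matroid_iso M N"
    unfolding matroid_iso_def N_def using inj by (auto intro!: exI[of _ f] simp: bij_betw_def)
  moreover have "indep N \<subseteq> Pow {..<n}"
    using img indep_subset_ground by (fastforce simp: N_def)
  moreover have "ground N \<subseteq> {..<n}"
    using img by (simp add: N_def)
  ultimately show ?thesis by blast
qed

text \<open>The type \<open>'a\<close> may be infinite, so classes are indexed by their copies on
  subsets of \<open>{..<n}\<close>, of which there are finitely many.\<close>

lemma finite_matroid_iso_classes:
  fixes A :: "'a set_system set"
  assumes "\<And>M. M \<in> A \<Longrightarrow> matroid M \<and> card (ground M) \<le> n"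
  shows "finite (A // matroid_iso_rel)"
proof -
  define T where "T = {N :: nat set_system. ground N \<subseteq> {..<n} \<and> indep N \<subseteq> Pow {..<n}}"
  \<comment> \<open>\<open>rep N\<close> is arbitrary when no member of \<open>A\<close> is
    isomorphic to \<open>N\<close>; this is harmless, as the image of \<open>T\<close> only has to
    cover the quotient.\<close>
  define rep where "rep N = (SOME M. M \<in> A \<and> matroid_iso M N)" for N :: "nat set_system"
  have "T \<subseteq> (\<lambda>(E, S). \<lparr>ground = E, indep = S\<rparr>) ` (Pow {..<n} \<times> Pow (Pow {..<n}))"
  proof
    fix N assume "N \<in> T"
    then show "N \<in> (\<lambda>(E, S). \<lparr>ground = E, indep = S\<rparr>) ` (Pow {..<n} \<times> Pow (Pow {..<n}))"
      by (intro image_eqI[of _ _ "(ground N, indep N)"]) (auto simp: T_def)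
  qed
  then have "finite T" by (rule finite_subset) simp
  moreover have "A // matroid_iso_rel \<subseteq> (\<lambda>N. matroid_iso_rel `` {rep N}) ` T"
  proof
    fix X assume "X \<in> A // matroid_iso_rel"
    then obtain M where M: "M \<in> A" "X = matroid_iso_rel `` {M}" by (rule quotientE)
    obtain N where N: "N \<in> T" "matroid_iso M N"
      using matroid.iso_to_initial_segment assms[OF M(1)] unfolding T_def by blast
    have "rep N \<in> A \<and> matroid_iso (rep N) N"
      unfolding rep_def by (rule someI[of _ M]) (use M N in simp)
    then have "(M, rep N) \<in> matroid_iso_rel"
      using M N assms by (auto simp: matroid_iso_rel_def intro: matroid_iso_trans matroid_iso_sym)
    then have "X = matroid_iso_rel `` {rep N}"
      using M equiv_class_eq[OF equiv_matroid_iso_rel] by simp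
    then show "X \<in> (\<lambda>N. matroid_iso_rel `` {rep N}) ` T" using N by blast
  qed
  ultimately show ?thesis by (meson finite_imageI finite_subset)
qed

theorem theorem1p1:
  fixes d k :: nat
  assumes "d > 0" and "k > 0"
  shows "finite ({M :: 'a set_system. matroid M \<and> loopless M \<and> matroid_rank M = d \<and>
           h_num (independence_complex M) d = int k} // matroid_iso_rel)"
proof (rule finite_matroid_iso_classes[where n = "d * (k + 1)"])
  fix M :: "'a set_system"
  assume "M \<in> {M. matroid M \<and> loopless M \<and> matroid_rank M = d \<and>
      h_num (independence_complex M) d = int k}"
  then have M: "matroid M" "loopless M" "matroid_rank M = d"
    "h_num (independence_complex M) d = int k" by auto
  interpret matroid M by fact
  have chi: "signed_euler_char M = int k"
    using coeff_h_poly_rank M by simp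
  \<comment> \<open>A coloop would make the value 0, against \<open>k > 0\<close>.\<close>
  then have "\<not> is_coloop M x" for x
    using signed_euler_char_coloop assms(2) by auto
  then have "card {x. {x} \<in> indep M} \<le> d * (k + 1)"
    using card_nonloops_le[OF M(1), of k] chi M(3) by simp
  moreover have "{x. {x} \<in> indep M} = ground M"
    using loopless_imp_singleton_indep[OF M(2)] indep_subset_ground by blast
  ultimately show "matroid M \<and> card (ground M) \<le> d * (k + 1)"
    using M(1) by simp
qed

end
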